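(* Let $n\ge 3$, let $K\subset\mathbb{R}^n$ be a hyperangle spanned by linearly independent vectors $e_1,\dots,e_n$, let $b\in K^+$, let $\mathcal{H}=\mathcal{H}(b)$, and let $A\in\mathcal{H}$. For $1\le i\le n$ let $A_i$ be the intersection point of $\mathcal{H}$ with the ray $\{te_i:t\ge 0\}$, let $\mathcal{A}=A_1A_2\dots A_n$ be the resulting $(n-1)$-simplex, let $M$ be the Monge point of $\mathcal{A}$, let $H$ be the orthogonal projection of $O$ on $\mathcal{H}$, and let $A'$ be the point defined by $\overrightarrow{OA'}=\frac{n-1}{2}\overrightarrow{OA}$. Then any two of the following three conditions imply the third one: (i) $\mathcal{H}$ is a stationary hyperplane for $A$; (ii) $A'A_1=A'A_2=\dots=A'A_n$ (equality of distances); (iii) $H=M$.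
   Context: $(\cdot,\cdot)$ is the standard inner product in $\mathbb{R}^n$ and $O$ is the origin. A hyperangle is a closed convex cone in $\mathbb{R}^n$ with vertex $O$ spanned by $n$ linearly independent vectors $e_1,\dots,e_n$, i.e. $K=\{\sum_i t_ie_i:t_i\ge 0\}$. The dual cone is $K^*=\{y:(y,x)\ge 0\ \forall x\in K\}$, and $K^+=(K^* )^o$ is its interior. For $b\ne 0$ let $\mathcal{H}(b)=\{x\in\mathbb{R}^n:(b,x)=1\}$, $K(b)=K\cap\mathcal{H}(b)$, and let $V(b)$ be the $(n-1)$-volume of $K(b)$. The hyperplane $\mathcal{H}(b)$ is called admissible if $b\in K^+$ (equivalently, $V(b)$ is finite and $K(b)$ is compact); in this case $\mathcal H(b)$ meets each ray spanned by $e_i$. For a point $A$ with position vector $a=\overrightarrow{OA}$, an admissible hyperplane $\mathcal{H}(b)$ containing $A$ is called a stationary hyperplane for $A$ if $b$ is a stationary point of $V$ under the constraint $(b,a)=1$, i.e. the gradient of $V$ at $b$ equals $\lambda a$ for some real $\lambda$. It is a known result that this is equivalent to $\overrightarrow{AH}=n\overrightarrow{AG}$, where $H$ is the orthogonal projection of $O$ on $\mathcal{H}(b)$ and $G$ is the centroid of $K(b)$. The Monge point of the $(n-1)$-simplex $\mathcal{A}$ ($n\ge 3$) is the common point of the hyperplanes (of the affine space $\mathcal{H}$ spanned by $\mathcal{A}$) that pass through the centroids of the $(n-3)$-dimensional faces of $\mathcal{A}$ and are orthogonal to the respective opposite edges of $\mathcal{A}$ (the edge opposite to an $(n-3)$-dimensional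 face is the one joining the two remaining vertices). *)

theory Defs
  imports "HOL-Analysis.Analysis"
begin

definition hyperangle :: "('i::finite \<Rightarrow> 'a::euclidean_space) \<Rightarrow> 'a set" where
  "hyperangle e = {(\<Sum>i\<in>UNIV. t i *\<^sub>R e i) | t. \<forall>i. 0 \<le> t i}"

definition dual_cone :: "'a::euclidean_space set \<Rightarrow> 'a set" where
  "dual_cone K = {y. \<forall>x\<in>K. 0 \<le> y \<bullet> x}"

definition hplane :: "'a::euclidean_space \<Rightarrow> 'a set" where
  "hplane b = {x. b \<bullet> x = 1}"

definition admissible :: "'a::euclidean_space set \<Rightarrow> 'a \<Rightarrow> bool" where
  "admissible K b \<longleftrightarrow> b \<in> interior (dual_cone K)"

definition orthonormal_basis_of :: "'a::euclidean_space set \<Rightarrow> 'a set \<Rightarrow> bool" where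
  "orthonormal_basis_of U B \<longleftrightarrow>
     B \<subseteq> U \<and> pairwise orthogonal B \<and> (\<forall>u\<in>B. norm u = 1) \<and> span B = U"

(* Lebesgue measure of dimension DIM('a) - 1 carried by the hyperplane hplane b (b nonzero):
   the image of the product Lebesgue measure under an isometric parametrization of hplane b
   with base point b / |b|^2, in the manner of the definition of lborel.  By the isometry
   invariance of Lebesgue measure it does not depend on the orthonormal basis chosen. *)
definition hplane_lborel :: "'a::euclidean_space \<Rightarrow> 'a measure" where
  "hplane_lborel b =
     (let B = (SOME B. orthonormal_basis_of {x. b \<bullet> x = 0} B)
      in distr (\<Pi>\<^sub>M u\<in>B. lborel) borel
           (\<lambda>f. (1 / (b \<bullet> b)) *\<^sub>R b + (\<Sum>u\<in>B. f u *\<^sub>R u)))"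

(* The volume of the section of K by hplane b.  It is real-valued, so a section of infinite
   volume gets the value 0; this does not occur on the open set of admissible b. *)
definition section_volume :: "'a::euclidean_space set \<Rightarrow> 'a \<Rightarrow> real" where
  "section_volume K b = measure (hplane_lborel b) (K \<inter> hplane b)"

definition stationary_hyperplane :: "'a::euclidean_space set \<Rightarrow> 'a \<Rightarrow> 'a \<Rightarrow> bool" where
  "stationary_hyperplane K a b \<longleftrightarrow>
     admissible K b \<and> a \<in> hplane b \<and> (\<exists>l::real. GDERIV (section_volume K) b :> l *\<^sub>R a)"

definition orthogonal_projection_of :: "'a::euclidean_space \<Rightarrow> 'a set \<Rightarrow> 'a \<Rightarrow> bool" where
  "orthogonal_projection_of x S p \<longleftrightarrow> p \<in> S \<and> (\<forall>y\<in>S. orthogonal (x - p) (y - p))"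

(* The simplex with vertices P i has CARD('i) vertices.  The face opposite to the edge
   joining P i and P j is spanned by the remaining CARD('i) - 2 vertices. *)
definition opposite_face_centroid :: "('i::finite \<Rightarrow> 'a::euclidean_space) \<Rightarrow> 'i \<Rightarrow> 'i \<Rightarrow> 'a" where
  "opposite_face_centroid P i j = (1 / real (CARD('i) - 2)) *\<^sub>R (\<Sum>k\<in>UNIV - {i, j}. P k)"

definition monge_hyperplane :: "('i::finite \<Rightarrow> 'a::euclidean_space) \<Rightarrow> 'i \<Rightarrow> 'i \<Rightarrow> 'a set" where
  "monge_hyperplane P i j =
     {x \<in> affine hull (range P). orthogonal (x - opposite_face_centroid P i j) (P j - P i)}"

definition monge_point :: "('i::finite \<Rightarrow> 'a::euclidean_space) \<Rightarrow> 'a" where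
  "monge_point P = (THE x. \<forall>i j. i \<noteq> j \<longrightarrow> x \<in> monge_hyperplane P i j)"

end

theory Submission
  imports Defs
begin

text \<open>
  Write \<open>P\<^sub>i = e\<^sub>i / (b \<bullet> e\<^sub>i)\<close> for the vertices and \<open>S\<close> for their sum.  The right prism of
  height 1 over the section of the cone is the image of a fixed body under an affine map whose linear
  part has determinant \<open>|b| * det P\<close> up to a constant factor.  Hence the volume of the section is a
  positive constant times \<open>|b| / \<Prod>\<^sub>i (b \<bullet> e\<^sub>i)\<close>; its gradient is a positive multiple of \<open>H - S\<close>,
  where \<open>H = b / |b|\<^sup>2\<close>, and \<open>b\<close> is stationary iff \<open>S - H = (n - 1) a\<close>.  The circumcentre condition says
  that \<open>P\<^sub>i + P\<^sub>j - (n - 1) a\<close> is orthogonal to \<open>P\<^sub>j - P\<^sub>i\<close> for all \<open>i\<close>, \<open>j\<close>; as \<open>H\<close> is orthogonal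
  to the edges, \<open>H\<close> is the Monge point iff \<open>S - P\<^sub>i - P\<^sub>j\<close> is orthogonal to \<open>P\<^sub>j - P\<^sub>i\<close>.
  The sum of the last two vectors is \<open>S - (n - 1) a\<close>, whose inner product with \<open>b\<close> is 1, so it is
  orthogonal to all edges iff it equals \<open>H\<close>.
\<close>

section \<open>Lebesgue measure under linear maps and orthonormal changes of coordinates\<close>

text \<open>The library's \<open>measure_linear_image\<close> is restricted to well-ordered index types.\<close>
lemma linear_image_measure:
  fixes f :: "real^'n \<Rightarrow> real^'n"
  assumes "linear f" "S \<in> lmeasurable"
  shows "f ` S \<in> lmeasurable \<and> measure lebesgue (f ` S) = \<bar>det (matrix f)\<bar> * measure lebesgue S"
proof -
  let ?P = "\<lambda>f :: real^'n \<Rightarrow> real^'n. \<forall>S\<in>lmeasurable. f ` S \<in> lmeasurable \<and>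
    measure lebesgue (f ` S) = \<bar>det (matrix f)\<bar> * measure lebesgue S"
  \<comment> \<open>For determinant 1 or -1 it suffices to preserve the measure of boxes:
    \<open>measure_linear_sufficient\<close> passes from boxes to all measurable sets.\<close>
  have elementary: "?P h" if "linear h" "\<bar>det (matrix h)\<bar> = 1"
    "\<And>a b. cbox a b \<noteq> {} \<Longrightarrow> measure lebesgue (h ` cbox a b) = measure lebesgue (cbox a b)"
    for h :: "real^'n \<Rightarrow> real^'n"
  proof
    fix S :: "(real^'n) set" assume S: "S \<in> lmeasurable"
    have im: "measure lebesgue (h ` cbox a b) = 1 * measure lebesgue (cbox a b)" for a b
      using that(3)[of a b] by (cases "cbox a b = {}") auto
    from measure_linear_sufficient[OF that(1) S im] that(2)
    show "h ` S \<in> lmeasurable \<and> measure lebesgue (h ` S) = \<bar>det (matrix h)\<bar> * measure lebesgue S"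
      by simp
  qed
  \<comment> \<open>Induction over compositions, maps with a vanishing coordinate, diagonal
    scalings, transpositions of coordinates and shears. A vanishing coordinate makes both the
    determinant and the measure of the image zero.\<close>
  have "?P f"
    using \<open>linear f\<close>
  proof (rule induct_linear_elementary)
    fix f g :: "real^'n \<Rightarrow> real^'n"
    assume "linear f" "linear g" "?P f" "?P g"
    then show "?P (f \<circ> g)"
      by (simp add: image_comp[symmetric] matrix_compose det_mul abs_mult del: o_apply)
  next
    fix f :: "real^'n \<Rightarrow> real^'n" and i
    assume f: "linear f" and "\<And>x. f x $ i = 0"
    then have "\<not> surj f"
      by (metis surjD vec_component zero_neq_one)
    then have "\<not> inj f"
      using f linear_injective_imp_surjective by blast
    then show "?P f"
      using f det_nz_iff_inj[OF f] negligible_linear_singular_image[OF f]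
      by (auto simp: negligible_imp_measure0 negligible_imp_measurable)
  next
    fix c :: "'n \<Rightarrow> real"
    have "det (matrix (\<lambda>x. \<chi> i. c i * x $ i)) = prod c UNIV"
      by (simp add: det_diagonal matrix_def axis_def)
    then show "?P (\<lambda>x. \<chi> i. c i * x $ i)"
      by (simp add: measurable_stretch measure_stretch)
  next
    fix m n :: 'n
    let ?s = "Transposition.transpose m n"
    let ?h = "\<lambda>x :: real^'n. \<chi> i. x $ ?s i"
    have "matrix ?h = (\<chi> i. mat 1 $ ?s i)"
      by (simp add: matrix_def mat_def axis_def vec_eq_iff)
    then have "\<bar>det (matrix ?h)\<bar> = 1"
      by (simp add: det_permute_rows permutes_swap_id sign_swap_id)
    moreover have "measure lebesgue (?h ` cbox a b) = measure lebesgue (cbox a b)"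
      if ne: "cbox a b \<noteq> {}" for a b
    proof -
      have "?h ` cbox a b = cbox (?h a) (?h b)"
      proof (intro equalityI subsetI)
        fix x assume "x \<in> cbox (?h a) (?h b)"
        then have "?h x \<in> cbox a b"
          by (auto simp: mem_box_cart) (metis transpose_involutory)+
        then show "x \<in> ?h ` cbox a b"
          by (force intro!: image_eqI[of x ?h "?h x"] simp: vec_eq_iff)
      qed (auto simp: mem_box_cart)
      moreover have "(\<Prod>i\<in>UNIV. (b - a) $ ?s i) = (\<Prod>i\<in>UNIV. (b - a) $ i)"
        using prod.permute[OF permutes_swap_id, of m UNIV n "\<lambda>i. (b - a) $ i"] by (simp add: o_def)
      moreover have "cbox (?h a) (?h b) \<noteq> {}"
        using ne by (auto simp: calculation(1)[symmetric])
      ultimately show ?thesis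
        using ne by (simp add: content_cbox_cart)
    qed
    ultimately show "?P ?h"
      by (intro elementary) (auto intro!: linearI simp: vec_eq_iff)
  next
    fix m n :: 'n assume mn: "m \<noteq> n"
    let ?h = "\<lambda>x :: real^'n. \<chi> i. if i = m then x $ m + x $ n else x $ i"
    have lin: "linear ?h"
      by (auto intro!: linearI simp: vec_eq_iff algebra_simps)
    have "matrix ?h = (\<chi> i. if i = m then row m (mat 1) + 1 *s row n (mat 1) else row i (mat 1))"
      by (simp add: matrix_def mat_def axis_def row_def vec_eq_iff)
    then have "det (matrix ?h) = 1"
      using det_row_operation[OF mn, of "mat 1 :: real^'n^'n" 1] by simp
    moreover have "measure lebesgue (?h ` cbox a b) = measure lebesgue (cbox a b)"
      if ne: "cbox a b \<noteq> {}" for a b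
    proof -
      \<comment> \<open>\<open>measure_shear_interval\<close> wants a nonnegative lower bound in
        coordinate \<open>n\<close>; translating by \<open>- ?v\<close> moves that bound to
        0.\<close>
      let ?v = "axis n (a $ n) :: real^'n"
      have box: "cbox a b = (+) ?v ` cbox (a - ?v) (b - ?v)"
        by (simp add: cbox_translation[symmetric])
      have "?h ` cbox a b = (+) (?h ?v) ` ?h ` cbox (a - ?v) (b - ?v)"
        by (subst box) (simp add: image_image linear_add[OF lin])
      then have "measure lebesgue (?h ` cbox a b) = measure lebesgue (?h ` cbox (a - ?v) (b - ?v))"
        by (simp only: measure_translation)
      also have "\<dots> = measure lebesgue (cbox (a - ?v) (b - ?v))"
        using ne by (intro measure_shear_interval[OF mn]) (auto simp: box)
      also have "\<dots> = measure lebesgue (cbox a b)"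
        by (simp only: box measure_translation)
      finally show ?thesis .
    qed
    ultimately show "?P ?h"
      by (intro elementary lin) auto
  qed
  with assms show ?thesis by blast
qed

text \<open>Boxes determine \<open>lborel\<close>, and the preimage of a box under \<open>T\<close>
  is its image under the inverse, whose determinant is 1 or -1.\<close>

lemma lborel_orthogonal_transformation:
  fixes T :: "real^'n \<Rightarrow> real^'n"
  assumes T: "orthogonal_transformation T"
  shows "distr lborel borel T = lborel"
proof (rule lborel_eqI[symmetric])
  fix l u :: "real^'n"
  assume lu: "\<And>b. b \<in> Basis \<Longrightarrow> l \<bullet> b \<le> u \<bullet> b"
  have lin: "linear T" and inv: "orthogonal_transformation (inv T)"
    using T by (auto simp: orthogonal_transformation_linear orthogonal_transformation_inv)
  have [measurable]: "T \<in> borel_measurable borel"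
    using lin by (intro borel_measurable_continuous_onI linear_continuous_on) (simp add: linear_linear)
  have "T -` box l u = inv T ` box l u"
    using orthogonal_transformation_bij[OF T] by (simp add: bij_vimage_eq_inv_image)
  moreover have "inv T ` box l u \<in> lmeasurable \<and> measure lebesgue (inv T ` box l u) = measure lebesgue (box l u)"
    using linear_image_measure[OF orthogonal_transformation_linear[OF inv], of "box l u"]
    by (simp add: orthogonal_transformation_det[OF inv])
  ultimately have "emeasure lebesgue (T -` box l u) = emeasure lebesgue (box l u)"
    by (simp add: emeasure_eq_measure2)
  moreover have "T -` box l u \<in> sets borel"
    using measurable_sets[of T borel borel "box l u"] by simp
  ultimately have "emeasure lborel (T -` box l u) = emeasure lborel (box l u)"
    by simp
  then show "emeasure (distr lborel borel T) (box l u) = (\<Prod>b\<in>Basis. (u - l) \<bullet> b)"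
    using lu by (simp add: emeasure_distr emeasure_lborel_box)
qed simp

text \<open>\<open>lborel\<close> is built from the standard basis. A bijection \<open>h\<close>
  from that basis onto \<open>C\<close> relabels coordinates, which preserves the product measure,
  and extends linearly to an orthogonal map \<open>T\<close>, which preserves
  \<open>lborel\<close>.\<close>

lemma lborel_orthonormal_basis:
  fixes C :: "(real^'n) set"
  assumes C: "orthonormal_basis_of UNIV C"
  shows "distr (\<Pi>\<^sub>M w\<in>C. lborel) borel (\<lambda>f. \<Sum>w\<in>C. f w *\<^sub>R w) = lborel"
proof -
  have C': "pairwise orthogonal C" "\<And>w. w \<in> C \<Longrightarrow> norm w = 1" "span C = UNIV"
    using C by (auto simp: orthonormal_basis_of_def)
  have ind: "independent C"
    using C'(1,2) by (intro pairwise_orthogonal_independent) force+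
  have fin: "finite C" using ind independent_imp_finite by blast
  have "card C = card (Basis :: (real^'n) set)"
    using ind C'(3) by (metis basis_card_eq_dim dim_UNIV top_greatest)
  then obtain h where h: "bij_betw h (Basis :: (real^'n) set) C"
    using fin finite_same_card_bij by (metis finite_Basis)
  define g where "g = the_inv_into Basis h"
  have g: "bij_betw g C Basis" and hg: "\<And>w. w \<in> C \<Longrightarrow> h (g w) = w" and gh: "\<And>i. i \<in> Basis \<Longrightarrow> g (h i) = i"
    unfolding g_def using h bij_betw_the_inv_into[OF h]
    by (auto simp: bij_betw_def f_the_inv_into_f the_inv_into_f_f)
  have inner_h: "h i \<bullet> h j = (if i = j then 1 else 0)" if "i \<in> Basis" "j \<in> Basis" for i j
  proof (cases "i = j")
    case True
    then show ?thesis using C'(2)[of "h i"] bij_betwE[OF h] that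
      by (auto simp: dot_square_norm)
  next
    case False
    then have "h i \<noteq> h j" using h that by (auto simp: bij_betw_def inj_on_def)
    then show ?thesis using C'(1) False bij_betwE[OF h] that
      by (auto simp: pairwise_def orthogonal_def)
  qed
  define T where "T = (\<lambda>x :: real^'n. \<Sum>i\<in>Basis. (x \<bullet> i) *\<^sub>R h i)"
  have "T x \<bullet> T y = x \<bullet> y" for x y
  proof -
    have "T x \<bullet> T y = (\<Sum>i\<in>Basis. \<Sum>j\<in>Basis. (x \<bullet> i) * ((y \<bullet> j) * (h i \<bullet> h j)))"
      by (simp add: T_def inner_sum_left inner_sum_right sum_distrib_left) (subst sum.swap, simp add: mult_ac)
    also have "\<dots> = (\<Sum>i\<in>Basis. \<Sum>j\<in>Basis. if i = j then (x \<bullet> i) * (y \<bullet> j) else 0)"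
      by (intro sum.cong refl) (simp add: inner_h)
    also have "\<dots> = x \<bullet> y" by (simp add: euclidean_inner[of x y])
    finally show ?thesis .
  qed
  moreover have "linear T"
    unfolding T_def by (intro linearI) (simp_all add: inner_add_left scaleR_add_left sum.distrib scaleR_sum_right)
  ultimately have T: "orthogonal_transformation T"
    by (simp add: orthogonal_transformation_def)
  interpret product_sigma_finite "\<lambda>_::real^'n. lborel :: real measure" by standard
  let ?r = "\<lambda>\<omega> :: real^'n \<Rightarrow> real. \<lambda>w\<in>C. \<omega> (g w)"
  have [measurable]: "?r \<in> (\<Pi>\<^sub>M i\<in>Basis. lborel) \<rightarrow>\<^sub>M (\<Pi>\<^sub>M w\<in>C. lborel)"
    using bij_betwE[OF g] by (intro measurable_restrict) (simp add: measurable_component_singleton)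
  have [measurable]: "T \<in> borel_measurable borel"
    unfolding T_def by measurable
  have "distr (\<Pi>\<^sub>M i\<in>Basis. lborel) (\<Pi>\<^sub>M w\<in>C. lborel) ?r = (\<Pi>\<^sub>M w\<in>C. lborel)"
  proof (rule PiM_eqI[OF fin])
    fix A :: "real^'n \<Rightarrow> real set" assume A: "\<And>w. w \<in> C \<Longrightarrow> A w \<in> sets lborel"
    have "?r -` (Pi\<^sub>E C A) \<inter> space (\<Pi>\<^sub>M i\<in>Basis. lborel) = Pi\<^sub>E Basis (\<lambda>i. A (h i))"
      using bij_betwE[OF g] bij_betwE[OF h] hg gh
      by (auto simp: space_PiM PiE_iff) metis+
    moreover have "(\<Prod>i\<in>Basis. emeasure lborel (A (h i))) = (\<Prod>w\<in>C. emeasure lborel (A w))"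
      using prod.reindex_bij_betw[OF h] .
    ultimately show "emeasure (distr (\<Pi>\<^sub>M i\<in>Basis. lborel) (\<Pi>\<^sub>M w\<in>C. lborel) ?r) (Pi\<^sub>E C A) = (\<Prod>w\<in>C. emeasure lborel (A w))"
      using A bij_betwE[OF h] fin by (simp add: emeasure_distr sets_PiM_I_finite emeasure_PiM)
  qed simp
  then have "distr (\<Pi>\<^sub>M w\<in>C. lborel) borel (\<lambda>f. \<Sum>w\<in>C. f w *\<^sub>R w) =
      distr (distr (\<Pi>\<^sub>M i\<in>Basis. lborel) (\<Pi>\<^sub>M w\<in>C. lborel) ?r) borel (\<lambda>f. \<Sum>w\<in>C. f w *\<^sub>R w)"
    by simp
  also have "\<dots> = distr (\<Pi>\<^sub>M i\<in>Basis. lborel) borel ((\<lambda>f. \<Sum>w\<in>C. f w *\<^sub>R w) \<circ> ?r)"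
    by (intro distr_distr) measurable
  also have "(\<lambda>f. \<Sum>w\<in>C. f w *\<^sub>R w) \<circ> ?r = T \<circ> (\<lambda>f. \<Sum>i\<in>Basis. f i *\<^sub>R i)"
  proof
    fix f :: "real^'n \<Rightarrow> real"
    have "(\<Sum>w\<in>C. f (g w) *\<^sub>R w) = (\<Sum>i\<in>Basis. f i *\<^sub>R h i)"
      using sum.reindex_bij_betw[OF h, of "\<lambda>w. f (g w) *\<^sub>R w"] by (simp add: gh cong: sum.cong)
    then show "((\<lambda>f. \<Sum>w\<in>C. f w *\<^sub>R w) \<circ> ?r) f = (T \<circ> (\<lambda>f. \<Sum>i\<in>Basis. f i *\<^sub>R i)) f"
      by (simp add: T_def inner_sum_left_Basis)
  qed
  also have "distr (\<Pi>\<^sub>M i\<in>Basis. lborel) borel (T \<circ> (\<lambda>f. \<Sum>i\<in>Basis. f i *\<^sub>R i)) = distr lborel borel T"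
    by (subst lborel_eq, subst distr_distr) (simp_all, measurable)
  also have "\<dots> = lborel"
    by (rule lborel_orthogonal_transformation[OF T])
  finally show ?thesis .
qed

section \<open>Measure on a hyperplane through prisms of height 1\<close>

text \<open>Adjoining the unit normal \<open>sgn b\<close> to the chosen basis \<open>B\<close> of
  the direction space gives an orthonormal basis of the whole space; integrating out the normal
  coordinate contributes the height 1. Thus the measure on the hyperplane becomes Lebesgue measure,
  to which determinants apply.\<close>

lemma emeasure_hplane_lborel_prism:
  fixes b :: "real^'n"
  assumes b: "b \<noteq> 0" and S: "S \<in> sets borel" "S \<subseteq> hplane b"
  shows "emeasure (hplane_lborel b) S = emeasure lborel {x + s *\<^sub>R sgn b | x s. x \<in> S \<and> s \<in> {0..1}}"
proof -
  let ?U = "{x. b \<bullet> x = 0}"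
  define B where "B = (SOME B. orthonormal_basis_of ?U B)"
  have "\<exists>B. orthonormal_basis_of ?U B"
    using orthonormal_basis_subspace[OF subspace_hyperplane[of b]]
    unfolding orthonormal_basis_of_def by metis
  then have "orthonormal_basis_of ?U B"
    unfolding B_def by (rule someI_ex)
  then have B: "B \<subseteq> ?U" "pairwise orthogonal B" "\<And>w. w \<in> B \<Longrightarrow> norm w = 1" "span B = ?U"
    by (auto simp: orthonormal_basis_of_def)
  have "independent B"
    using B(2,3) by (intro pairwise_orthogonal_independent) force+
  then have fin: "finite B" using independent_imp_finite by blast
  let ?u = "sgn b" and ?c = "(1 / (b \<bullet> b)) *\<^sub>R b"
  let ?p = "\<lambda>f :: real^'n \<Rightarrow> real. ?c + (\<Sum>w\<in>B. f w *\<^sub>R w)"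
  have u: "norm ?u = 1" "b \<bullet> ?u = norm b" "?u \<bullet> ?u = 1"
    using b by (auto simp: norm_sgn sgn_div_norm dot_square_norm power2_eq_square)
  have c: "?c = (1 / norm b) *\<^sub>R ?u"
    using b by (simp add: sgn_div_norm dot_square_norm power2_eq_square divide_inverse)
  have perp: "w \<bullet> ?u = 0" if "w \<in> B" for w
    using B(1) that by (auto simp: sgn_div_norm inner_commute)
  then have uB: "?u \<notin> B" using u(3) by auto
  have "x \<in> span (insert ?u B)" for x
  proof -
    have "x - (b \<bullet> x / norm b) *\<^sub>R ?u \<in> ?U"
      using u(2) b by (simp add: inner_diff_right)
    then show ?thesis
      unfolding span_insert B(4) by blast
  qed
  then have "orthonormal_basis_of UNIV (insert ?u B)"
    using B perp u by (auto simp: orthonormal_basis_of_def pairwise_insert orthogonal_def inner_commute)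
  note lb = lborel_orthonormal_basis[OF this]
  define Q where "Q = {x + s *\<^sub>R ?u | x s. x \<in> S \<and> s \<in> {0..1}}"
  have S_u: "x \<bullet> ?u = 1 / norm b" if "x \<in> S" for x
    using S(2) that b by (auto simp: hplane_def sgn_div_norm inner_commute field_simps)
  \<comment> \<open>The hyperplane has distance \<open>1 / norm b\<close> from the origin, so
    \<open>p \<bullet> sgn b - 1 / norm b\<close> is the height of \<open>p\<close> above it. In
    this form \<open>Q\<close> is visibly measurable.\<close>
  have Q_iff: "p \<in> Q \<longleftrightarrow> p \<bullet> ?u - 1 / norm b \<in> {0..1} \<and> p - (p \<bullet> ?u - 1 / norm b) *\<^sub>R ?u \<in> S" for p
  proof
    assume "p \<in> Q"
    then obtain x s where "p = x + s *\<^sub>R ?u" "x \<in> S" "s \<in> {0..1}"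
      by (auto simp: Q_def)
    then show "p \<bullet> ?u - 1 / norm b \<in> {0..1} \<and> p - (p \<bullet> ?u - 1 / norm b) *\<^sub>R ?u \<in> S"
      using S_u[of x] u by (simp add: inner_add_left)
  next
    assume "p \<bullet> ?u - 1 / norm b \<in> {0..1} \<and> p - (p \<bullet> ?u - 1 / norm b) *\<^sub>R ?u \<in> S"
    then show "p \<in> Q" unfolding Q_def
      by (intro CollectI exI[of _ "p - (p \<bullet> ?u - 1 / norm b) *\<^sub>R ?u"] exI[of _ "p \<bullet> ?u - 1 / norm b"]) simp
  qed
  have S_meas [measurable]: "Measurable.pred borel (\<lambda>x. x \<in> S)"
    using S(1) by simp
  have Q_meas [measurable]: "Measurable.pred borel (\<lambda>x. x \<in> Q)"
    unfolding Q_iff by measurable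
  have Q_borel: "Q \<in> sets borel"
    using Q_meas by (simp add: pred_def)
  have [measurable]: "(\<lambda>f. \<Sum>w\<in>insert ?u B. f w *\<^sub>R w) \<in> borel_measurable (\<Pi>\<^sub>M w\<in>insert ?u B. lborel)"
    "?p \<in> borel_measurable (\<Pi>\<^sub>M w\<in>B. lborel)"
    by measurable
  interpret product_sigma_finite "\<lambda>_::real^'n. lborel :: real measure" by standard
  \<comment> \<open>The indicator factorises, and the normal coordinate \<open>y\<close> runs over
    an interval of length 1.\<close>
  have split: "indicator Q (\<Sum>w\<in>insert ?u B. (f(?u := y)) w *\<^sub>R w) =
      (indicator {1 / norm b..1 + 1 / norm b} y * indicator S (?p f) :: ennreal)" for f y
  proof -
    have sum: "(\<Sum>w\<in>insert ?u B. (f(?u := y)) w *\<^sub>R w) = y *\<^sub>R ?u + (\<Sum>w\<in>B. f w *\<^sub>R w)"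
      using fin uB by (simp add: sum.insert) (intro sum.cong, auto)
    have coord: "(y *\<^sub>R ?u + (\<Sum>w\<in>B. f w *\<^sub>R w)) \<bullet> ?u = y"
      using u perp by (simp add: inner_add_left inner_sum_left)
    have proj: "y *\<^sub>R ?u + (\<Sum>w\<in>B. f w *\<^sub>R w) - (y - 1 / norm b) *\<^sub>R ?u = ?p f"
      unfolding c by (simp add: algebra_simps)
    show ?thesis
      by (simp only: sum indicator_def Q_iff coord proj) auto
  qed
  have "emeasure lborel Q = (\<integral>\<^sup>+ x. indicator Q x \<partial>lborel)"
    using Q_borel by simp
  also have "\<dots> = (\<integral>\<^sup>+ f. indicator Q (\<Sum>w\<in>insert ?u B. f w *\<^sub>R w) \<partial>(\<Pi>\<^sub>M w\<in>insert ?u B. lborel))"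
    using Q_borel by (subst lb[symmetric], subst nn_integral_distr) auto
  also have "\<dots> = (\<integral>\<^sup>+ f. \<integral>\<^sup>+ y. indicator Q (\<Sum>w\<in>insert ?u B. (f(?u := y)) w *\<^sub>R w) \<partial>lborel \<partial>(\<Pi>\<^sub>M w\<in>B. lborel))"
    using fin uB Q_borel by (intro product_nn_integral_insert) measurable
  also have "\<dots> = (\<integral>\<^sup>+ f. indicator S (?p f) \<partial>(\<Pi>\<^sub>M w\<in>B. lborel))"
    unfolding split by (simp add: nn_integral_multc)
  also have "\<dots> = emeasure (distr (\<Pi>\<^sub>M w\<in>B. lborel) borel ?p) S"
    using S(1) by (subst nn_integral_distr[symmetric, where M' = borel]) (auto simp: nn_integral_indicator)
  also have "distr (\<Pi>\<^sub>M w\<in>B. lborel) borel ?p = hplane_lborel b"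
    by (simp add: hplane_lborel_def B_def Let_def)
  finally show ?thesis by (simp add: Q_def)
qed

section \<open>Linear algebra of the vertices and the model prism\<close>

text \<open>\<open>independent (range e)\<close> speaks of a set; injectivity of \<open>e\<close>
  turns a linear relation among the indexed rows into one among its elements.\<close>

lemma det_rows_nonzero:
  fixes e :: "'n::finite \<Rightarrow> real^'n"
  assumes "inj e" "independent (range e)"
  shows "det (\<chi> i. e i) \<noteq> 0"
proof -
  have "c i = 0" if "(\<Sum>i\<in>UNIV. c i *s row i (\<chi> i. e i)) = 0" for c i
  proof -
    have "(\<Sum>v\<in>range e. c (inv e v) *\<^sub>R v) = 0"
      using that assms(1) by (simp add: sum.reindex row_def scalar_mult_eq_scaleR)
    then have "c (inv e (e i)) = 0"
      using independentD[OF assms(2), of "range e" "\<lambda>v. c (inv e v)" "e i"] by simp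
    then show ?thesis using assms(1) by simp
  qed
  then have "\<exists>B. (\<chi> i. e i) ** B = mat 1"
    unfolding matrix_right_invertible_independent_rows by blast
  then show ?thesis
    by (simp flip: invertible_det_nz add: invertible_right_inverse)
qed

lemma obtain_coefficients:
  fixes P :: "'n::finite \<Rightarrow> real^'n"
  assumes "det (\<chi> i. P i) \<noteq> 0"
  obtains c where "x = (\<Sum>i\<in>UNIV. c i *\<^sub>R P i)"
proof -
  have "invertible (transpose (\<chi> i. P i))"
    using assms by (simp add: invertible_det_nz)
  then obtain y where "transpose (\<chi> i. P i) *v y = x"
    by (metis invertible_right_inverse matrix_right_invertible_surjective surjD)
  then have "x = (\<Sum>i\<in>UNIV. y $ i *\<^sub>R P i)"
    by (auto simp: matrix_vector_mult_def transpose_def vec_eq_iff mult.commute)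
  then show ?thesis by (rule that)
qed

lemma obtain_inner_products:
  fixes P :: "'n::finite \<Rightarrow> real^'n"
  assumes "det (\<chi> i. P i) \<noteq> 0"
  obtains x where "\<And>i. x \<bullet> P i = r i"
proof -
  have "invertible (\<chi> i. P i)"
    using assms by (simp add: invertible_det_nz)
  then obtain x where "(\<chi> i. P i) *v x = (\<chi> i. r i)"
    by (metis invertible_right_inverse matrix_right_invertible_surjective surjD)
  then have "x \<bullet> P i = r i" for i
    by (simp add: vec_eq_iff matrix_vector_mul_component inner_commute)
  then show ?thesis by (rule that)
qed

lemma compact_std_simplex_cart:
  "compact {y :: real^'n. (\<forall>i. 0 \<le> y $ i) \<and> (\<Sum>i\<in>UNIV. y $ i) = 1}" (is "compact ?D")
  unfolding compact_eq_bounded_closed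
proof
  have "norm y \<le> 1" if "y \<in> ?D" for y
    using norm_le_l1_cart[of y] that by simp
  then show "bounded ?D"
    by (auto simp: bounded_iff)
  show "closed ?D"
    by (intro closed_Collect_conj closed_Collect_all closed_Collect_le closed_Collect_eq continuous_intros)
qed

text \<open>This is the fixed body of which all prisms are affine images: a corner simplex in the
  coordinates other than \<open>k\<close>, times the unit interval in coordinate \<open>k\<close>.
  Each factor contributes at most 1 to the sum of coordinates, whence the bound 2.\<close>

lemma compact_prism_cart:
  "compact {z :: real^'n. (\<forall>i. 0 \<le> z $ i) \<and> (\<Sum>i\<in>UNIV - {k}. z $ i) \<le> 1 \<and> z $ k \<le> 1}" (is "compact ?D")
  unfolding compact_eq_bounded_closed
proof
  have "norm z \<le> 2" if "z \<in> ?D" for z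
    using norm_le_l1_cart[of z] that by (simp add: sum.remove[of UNIV k])
  then show "bounded ?D"
    by (auto simp: bounded_iff)
  show "closed ?D"
    by (intro closed_Collect_conj closed_Collect_all closed_Collect_le continuous_intros)
qed

text \<open>A cube of side \<open>1 / CARD('n)\<close> fits inside. The exact value of the measure
  is absorbed into the constant of the volume formula.\<close>

lemma measure_prism_cart_pos:
  "measure lebesgue {z :: real^'n. (\<forall>i. 0 \<le> z $ i) \<and> (\<Sum>i\<in>UNIV - {k}. z $ i) \<le> 1 \<and> z $ k \<le> 1} > 0"
    (is "measure lebesgue ?D > 0")
proof -
  let ?C = "cbox 0 (\<chi> i. 1 / real CARD('n)) :: (real^'n) set"
  have "?C \<subseteq> ?D"
  proof
    fix z assume "z \<in> ?C"
    then have z: "\<And>i. 0 \<le> z $ i" "\<And>i. z $ i \<le> 1 / real CARD('n)"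
      by (auto simp: mem_box_cart)
    have "(\<Sum>i\<in>UNIV. z $ i) \<le> 1"
      using sum_mono[of UNIV "\<lambda>i. z $ i" "\<lambda>i. 1 / real CARD('n)"] z by simp
    moreover have "0 \<le> (\<Sum>i\<in>UNIV - {k}. z $ i)"
      by (intro sum_nonneg z)
    moreover have "(\<Sum>i\<in>UNIV. z $ i) = z $ k + (\<Sum>i\<in>UNIV - {k}. z $ i)"
      by (simp add: sum.remove[of UNIV k])
    ultimately have "(\<Sum>i\<in>UNIV - {k}. z $ i) \<le> 1" "z $ k \<le> 1"
      using z(1)[of k] by linarith+
    then show "z \<in> ?D"
      using z(1) by simp
  qed
  then have "measure lebesgue ?C \<le> measure lebesgue ?D"
    by (intro measure_mono_fmeasurable lmeasurable_compact compact_prism_cart) auto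
  moreover have "measure lebesgue ?C > 0"
    using content_cbox_cart[of 0 "(\<chi> i. 1 / real CARD('n)) :: real^'n"]
    by (auto simp: interval_eq_empty_cart prod_pos)
  ultimately show ?thesis by linarith
qed

section \<open>Volume of the section as a function of the hyperplane\<close>

text \<open>The substitution \<open>y i = t i * (b \<bullet> e i)\<close> turns the equation of the
  hyperplane into the condition that the coefficients sum to 1.\<close>

lemma hyperangle_Int_hplane:
  assumes pos: "\<And>i. b \<bullet> e i > 0"
  shows "hyperangle e \<inter> hplane b =
    {\<Sum>i\<in>UNIV. y i *\<^sub>R ((1 / (b \<bullet> e i)) *\<^sub>R e i) | y. (\<forall>i. 0 \<le> y i) \<and> (\<Sum>i\<in>UNIV. y i) = 1}"
    (is "?L = ?R")
proof (intro equalityI subsetI)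
  fix x assume "x \<in> ?L"
  then obtain t where t: "x = (\<Sum>i\<in>UNIV. t i *\<^sub>R e i)" "\<And>i. 0 \<le> t i" "b \<bullet> x = 1"
    by (auto simp: hyperangle_def hplane_def)
  then show "x \<in> ?R"
    using pos by (intro CollectI exI[of _ "\<lambda>i. t i * (b \<bullet> e i)"])
      (auto simp: inner_sum_right less_imp_le less_imp_neq[THEN not_sym])
next
  fix x assume "x \<in> ?R"
  then obtain y where y: "x = (\<Sum>i\<in>UNIV. y i *\<^sub>R ((1 / (b \<bullet> e i)) *\<^sub>R e i))" "\<And>i. 0 \<le> y i" "(\<Sum>i\<in>UNIV. y i) = 1"
    by auto
  then have "x \<in> hyperangle e" unfolding hyperangle_def
    using pos by (intro CollectI exI[of _ "\<lambda>i. y i / (b \<bullet> e i)"]) (auto simp: less_imp_le)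
  moreover have "x \<in> hplane b"
    using y pos by (simp add: hplane_def inner_sum_right less_imp_neq[THEN not_sym])
  ultimately show "x \<in> ?L" by simp
qed

text \<open>\<open>C\<close> is fixed before \<open>b\<close>, so the formula can be differentiated
  in \<open>b\<close>. The prism is a translate of the image of \<open>D\<close> under a linear map
  \<open>L\<close>, and all dependence on \<open>b\<close> sits in
  \<open>det (matrix L)\<close>.\<close>

lemma section_volume_hyperangle:
  fixes e :: "'n::finite \<Rightarrow> real^'n"
  assumes e: "inj e" "independent (range e)"
  obtains C where "C > 0"
    "\<And>b. (\<And>i. b \<bullet> e i > 0) \<Longrightarrow> section_volume (hyperangle e) b = C * norm b * (\<Prod>i\<in>UNIV. 1 / (b \<bullet> e i))"
proof -
  \<comment> \<open>An arbitrary index: \<open>P k\<close> will be the base point of the simplex,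
    and coordinate \<open>k\<close> of the model will be the height of the prism.\<close>
  obtain k :: 'n where True by simp
  \<comment> \<open>Left multiplication by \<open>W\<close> subtracts row \<open>k\<close> from
    every other row. Its determinant goes into \<open>C\<close>, so only
    \<open>det W \<noteq> 0\<close> matters.\<close>
  define W :: "real^'n^'n" where "W = (\<chi> i. if i = k then axis k 1 else axis i 1 - axis k 1)"
  define D where "D = {z :: real^'n. (\<forall>i. 0 \<le> z $ i) \<and> (\<Sum>i\<in>UNIV - {k}. z $ i) \<le> 1 \<and> z $ k \<le> 1}"
  define C where "C = \<bar>det W\<bar> * \<bar>det (\<chi> i. e i)\<bar> * measure lebesgue D"
  have "det W \<noteq> 0"
  proof -
    have "c i = 0" if "(\<Sum>i\<in>UNIV. c i *s row i W) = 0" for c i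
    proof -
      have eq: "(\<Sum>i\<in>UNIV. c i * W $ i $ j) = 0" for j
        using that by (simp add: vec_eq_iff row_def)
      have c: "c j = 0" if "j \<noteq> k" for j
      proof -
        have "c i * W $ i $ j = (if i = j then c i else 0)" for i
          using that by (auto simp: W_def axis_def)
        then show ?thesis using eq[of j] by simp
      qed
      then have "c i * W $ i $ k = (if i = k then c i else 0)" for i
        by (auto simp: W_def axis_def)
      then have "c k = 0" using eq[of k] by simp
      with c show ?thesis by metis
    qed
    then have "\<exists>B. W ** B = mat 1"
      unfolding matrix_right_invertible_independent_rows by blast
    then show ?thesis
      by (simp flip: invertible_det_nz add: invertible_right_inverse)
  qed
  then have "C > 0"
    using det_rows_nonzero[OF e] measure_prism_cart_pos[of k] by (simp add: C_def D_def)
  moreover have "section_volume (hyperangle e) b = C * norm b * (\<Prod>i\<in>UNIV. 1 / (b \<bullet> e i))"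
    if pos: "\<And>i. b \<bullet> e i > 0" for b
  proof -
    define P where "P i = (1 / (b \<bullet> e i)) *\<^sub>R e i" for i
    have bP: "b \<bullet> P i = 1" for i
      using pos[of i] by (simp add: P_def)
    have b0: "b \<noteq> 0" using pos[of k] by auto
    define S where "S = hyperangle e \<inter> hplane b"
    have S: "S = {\<Sum>i\<in>UNIV. y i *\<^sub>R P i | y. (\<forall>i. 0 \<le> y i) \<and> (\<Sum>i\<in>UNIV. y i) = 1}"
      unfolding S_def P_def by (rule hyperangle_Int_hplane[OF pos])
    have "S = (\<lambda>y. \<Sum>i\<in>UNIV. y $ i *\<^sub>R P i) ` {y. (\<forall>i. 0 \<le> y $ i) \<and> (\<Sum>i\<in>UNIV. y $ i) = 1}"
    proof (intro equalityI subsetI)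
      fix x assume "x \<in> S"
      then obtain y where "x = (\<Sum>i\<in>UNIV. y i *\<^sub>R P i)" "\<forall>i. 0 \<le> y i" "(\<Sum>i\<in>UNIV. y i) = 1"
        unfolding S by blast
      then show "x \<in> (\<lambda>y. \<Sum>i\<in>UNIV. y $ i *\<^sub>R P i) ` {y. (\<forall>i. 0 \<le> y $ i) \<and> (\<Sum>i\<in>UNIV. y $ i) = 1}"
        by (intro image_eqI[of _ _ "\<chi> i. y i"]) auto
    qed (auto simp: S)
    then have "compact S"
      by (simp only:) (intro compact_continuous_image compact_std_simplex_cart continuous_intros)
    then have "S \<in> sets borel"
      by (intro borel_closed compact_imp_closed)
    \<comment> \<open>The columns of the matrix of \<open>L\<close>: the edges from
      \<open>P k\<close>, with the unit normal in slot \<open>k\<close>, where the edge would be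
      0.\<close>
    define r where "r i = (if i = k then sgn b else P i - P k)" for i
    define L where "L z = (\<Sum>i\<in>UNIV. z $ i *\<^sub>R r i)" for z :: "real^'n"
    have "linear L"
      unfolding L_def by (intro linearI) (simp_all add: scaleR_add_left sum.distrib scaleR_sum_right)
    have sum_r: "P k + L z = z $ k *\<^sub>R sgn b + (1 - (\<Sum>i\<in>UNIV - {k}. z $ i)) *\<^sub>R P k + (\<Sum>i\<in>UNIV - {k}. z $ i *\<^sub>R P i)" for z
    proof -
      have "L z = z $ k *\<^sub>R sgn b + (\<Sum>i\<in>UNIV - {k}. z $ i *\<^sub>R P i - z $ i *\<^sub>R P k)"
        by (simp add: L_def sum.remove[of UNIV k] r_def scaleR_diff_right)
      then show ?thesis
        by (simp add: sum_subtractf scaleR_sum_left algebra_simps)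
    qed
    have Q: "{x + s *\<^sub>R sgn b | x s. x \<in> S \<and> s \<in> {0..1}} = (+) (P k) ` L ` D" (is "?Q = _")
    proof (intro equalityI subsetI)
      fix p assume "p \<in> ?Q"
      then obtain y s where y: "p = (\<Sum>i\<in>UNIV. y i *\<^sub>R P i) + s *\<^sub>R sgn b" "\<And>i. 0 \<le> y i"
        "(\<Sum>i\<in>UNIV. y i) = 1" "0 \<le> s" "s \<le> 1"
        unfolding S by auto
      \<comment> \<open>Slot \<open>k\<close> is free to hold the height \<open>s\<close>, because
        the weight of \<open>P k\<close> is one minus the other weights.\<close>
      let ?z = "\<chi> i. if i = k then s else y i"
      have sums: "(\<Sum>i\<in>UNIV - {k}. ?z $ i) = (\<Sum>i\<in>UNIV - {k}. y i)"
        "(\<Sum>i\<in>UNIV - {k}. ?z $ i *\<^sub>R P i) = (\<Sum>i\<in>UNIV - {k}. y i *\<^sub>R P i)"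
        by (auto intro!: sum.cong)
      have yk: "y k = 1 - (\<Sum>i\<in>UNIV - {k}. y i)"
        using y(3) by (simp add: sum.remove[of UNIV k])
      have "p = P k + L ?z"
        unfolding sum_r sums y(1) sum.remove[OF finite UNIV_I, of "\<lambda>i. y i *\<^sub>R P i" k] yk by simp
      moreover have "?z \<in> D"
        using y(2)[of k] y(2,4,5) yk sums by (auto simp: D_def)
      ultimately show "p \<in> (+) (P k) ` L ` D" by blast
    next
      fix p assume "p \<in> (+) (P k) ` L ` D"
      then obtain z where z: "p = P k + L z" "z \<in> D" by blast
      let ?y = "\<lambda>i. if i = k then 1 - (\<Sum>i\<in>UNIV - {k}. z $ i) else z $ i"
      have "(\<Sum>i\<in>UNIV. ?y i) = 1"
        by (simp add: sum.remove[of UNIV k])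
      moreover have yP: "(\<Sum>i\<in>UNIV. ?y i *\<^sub>R P i) = (1 - (\<Sum>i\<in>UNIV - {k}. z $ i)) *\<^sub>R P k + (\<Sum>i\<in>UNIV - {k}. z $ i *\<^sub>R P i)"
        by (simp add: sum.remove[of UNIV k])
      have "p = (\<Sum>i\<in>UNIV. ?y i *\<^sub>R P i) + z $ k *\<^sub>R sgn b"
        unfolding yP z(1) sum_r by (simp only: add_ac)
      moreover have "\<forall>i. 0 \<le> ?y i" "z $ k \<in> {0..1}"
        using z(2) by (auto simp: D_def)
      moreover from calculation have "(\<Sum>i\<in>UNIV. ?y i *\<^sub>R P i) \<in> S"
        unfolding S by (intro CollectI exI[of _ ?y]) simp
      ultimately show "p \<in> ?Q"
        by blast
    qed
    have D: "D \<in> lmeasurable"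
      unfolding D_def by (intro lmeasurable_compact compact_prism_cart)
    have "compact ?Q"
      unfolding Q using \<open>linear L\<close> compact_prism_cart[of k]
      by (intro compact_translation compact_continuous_image linear_continuous_on)
        (simp_all add: D_def linear_linear)
    then have "?Q \<in> sets lborel" by (simp add: borel_compact)
    have "section_volume (hyperangle e) b = measure lborel ?Q"
      unfolding section_volume_def S_def[symmetric] measure_def
      using emeasure_hplane_lborel_prism[OF b0 \<open>S \<in> sets borel\<close>] by (simp add: S_def)
    also have "\<dots> = measure lebesgue ?Q"
      using \<open>?Q \<in> sets lborel\<close> by (simp add: measure_completion)
    also have "\<dots> = measure lebesgue (L ` D)"
      unfolding Q by (rule measure_translation)
    also have "\<dots> = \<bar>det (matrix L)\<bar> * measure lebesgue D"
      using linear_image_measure[OF \<open>linear L\<close> D] by blast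
    also have "det (matrix L) = norm b * (det W * ((\<Prod>i\<in>UNIV. 1 / (b \<bullet> e i)) * det (\<chi> i. e i)))"
    proof -
      \<comment> \<open>\<open>A\<close> has \<open>P k\<close> in the row where the matrix of
        \<open>r\<close> has \<open>sgn b\<close>. Row operations and rescaling give
        \<open>det A\<close>; exchanging row \<open>k\<close> will cost the factor
        \<open>norm b\<close>.\<close>
      define A where "A = (\<chi> i. if i = k then P k else P i - P k)"
      have A: "A = W ** (\<chi> i. P i)"
      proof -
        have "(W ** (\<chi> i. P i)) $ i $ j = A $ i $ j" for i j
        proof -
          have ax: "(\<Sum>l\<in>UNIV. axis i 1 $ l * P l $ j) = P i $ j" for i
            by (simp add: axis_def if_distrib[of "\<lambda>x. x * _"] cong: if_cong)
          show ?thesis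
            by (simp add: A_def W_def matrix_matrix_mult_def left_diff_distrib sum_subtractf ax)
        qed
        then show ?thesis by (simp add: vec_eq_iff)
      qed
      have detP: "det (\<chi> i. P i) = (\<Prod>i\<in>UNIV. 1 / (b \<bullet> e i)) * det (\<chi> i. e i)"
        unfolding P_def scalar_mult_eq_scaleR[symmetric] by (rule det_rows_mul)
      have detA: "det A = det W * ((\<Prod>i\<in>UNIV. 1 / (b \<bullet> e i)) * det (\<chi> i. e i))"
        by (simp add: A det_mul detP)
      have "(\<Prod>i\<in>UNIV. 1 / (b \<bullet> e i)) \<noteq> 0"
        using pos by (simp add: less_imp_neq[THEN not_sym])
      then have "det (\<chi> i. A $ i) \<noteq> 0"
        using detA \<open>det W \<noteq> 0\<close> det_rows_nonzero[OF e] by simp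
      \<comment> \<open>\<open>b\<close> pairs to 1 with row \<open>k\<close> of \<open>A\<close>
        and to 0 with the other rows, so pairing this expansion with \<open>b\<close> isolates
        \<open>c k\<close>.\<close>
      then obtain c where c: "sgn b = (\<Sum>i\<in>UNIV. c i *\<^sub>R A $ i)"
        using obtain_coefficients[of "\<lambda>i. A $ i" "sgn b"] by blast
      have bA: "b \<bullet> A $ i = (if i = k then 1 else 0)" for i
        by (simp add: A_def bP inner_diff_right)
      have "b \<bullet> sgn b = c k"
        unfolding c by (simp add: inner_sum_right bA if_distrib cong: if_cong)
      moreover have "b \<bullet> sgn b = norm b"
        using b0 by (simp add: sgn_div_norm dot_square_norm power2_eq_square)
      ultimately have ck: "c k = norm b" by simp
      have "matrix L = transpose (\<chi> i. r i)"
        by (simp add: matrix_def L_def transpose_def vec_eq_iff axis_def if_distrib[of "\<lambda>x. x * _"] cong: if_cong)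
      then have "det (matrix L) = det (\<chi> i. r i)"
        by simp
      \<comment> \<open>Cramer's rule: replacing row \<open>k\<close> by a combination of all rows
        multiplies the determinant by the coefficient of row \<open>k\<close>.\<close>
      also have "(\<chi> i. r i) = (\<chi> i. if i = k then \<Sum>i\<in>UNIV. (\<chi> i. c i) $ i *s row i A else row i A)"
        by (simp add: vec_eq_iff r_def c scalar_mult_eq_scaleR row_def A_def)
      also have "det \<dots> = norm b * det A"
        unfolding cramer_lemma_transpose by (simp add: ck)
      finally show ?thesis by (simp add: detA)
    qed
    finally show ?thesis
      using pos by (simp add: C_def abs_mult prod_nonneg less_imp_le)
  qed
  ultimately show ?thesis by (rule that)
qed

section \<open>Gradient of the volume and stationarity\<close>

text \<open>This has the shape of a logarithmic derivative: the value at \<open>b\<close> times the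
  sum of the logarithmic gradients of the norm and of the factors
  \<open>1 / (x \<bullet> e i)\<close>.\<close>

lemma GDERIV_norm_mult_prod:
  fixes b :: "'a::euclidean_space" and e :: "'i::finite \<Rightarrow> 'a"
  assumes b: "b \<noteq> 0" and nz: "\<And>i. b \<bullet> e i \<noteq> 0"
  shows "GDERIV (\<lambda>x. C * norm x * (\<Prod>i\<in>UNIV. 1 / (x \<bullet> e i))) b :>
    (C * norm b * (\<Prod>i\<in>UNIV. 1 / (b \<bullet> e i))) *\<^sub>R
      ((1 / (b \<bullet> b)) *\<^sub>R b - (\<Sum>i\<in>UNIV. (1 / (b \<bullet> e i)) *\<^sub>R e i))"
proof -
  let ?p = "\<Prod>i\<in>UNIV. 1 / (b \<bullet> e i)"
  have "((\<lambda>x. 1 / (x \<bullet> e i)) has_derivative (\<lambda>h. - (h \<bullet> e i) / (b \<bullet> e i)\<^sup>2)) (at b)" for i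
    using nz[of i] by (auto intro!: derivative_eq_intros simp: power2_eq_square field_simps)
  from has_derivative_prod[of UNIV, OF this]
  have "((\<lambda>x. \<Prod>i\<in>UNIV. 1 / (x \<bullet> e i)) has_derivative
      (\<lambda>h. \<Sum>i\<in>UNIV. - (h \<bullet> e i) / (b \<bullet> e i)\<^sup>2 * (\<Prod>j\<in>UNIV - {i}. 1 / (b \<bullet> e j)))) (at b)" .
  moreover have "- (h \<bullet> e i) / (b \<bullet> e i)\<^sup>2 * (\<Prod>j\<in>UNIV - {i}. 1 / (b \<bullet> e j)) = h \<bullet> (- ?p *\<^sub>R ((1 / (b \<bullet> e i)) *\<^sub>R e i))" for h i
    using nz[of i] by (simp add: prod.remove[of UNIV i] power2_eq_square)
  ultimately have prod: "GDERIV (\<lambda>x. \<Prod>i\<in>UNIV. 1 / (x \<bullet> e i)) b :> - ?p *\<^sub>R (\<Sum>i\<in>UNIV. (1 / (b \<bullet> e i)) *\<^sub>R e i)"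
    by (simp only: gderiv_def scaleR_sum_right inner_sum_right)
  have "GDERIV (\<lambda>x. C * norm x) b :> C *\<^sub>R sgn b + norm b *\<^sub>R 0"
    by (intro GDERIV_mult GDERIV_norm GDERIV_const b)
  from GDERIV_mult[OF this prod] show ?thesis
  proof (rule GDERIV_subst)
    have "?p *\<^sub>R C *\<^sub>R sgn b = (C * norm b * ?p) *\<^sub>R ((1 / (b \<bullet> b)) *\<^sub>R b)"
      using b by (simp add: sgn_div_norm dot_square_norm power2_eq_square divide_inverse)
    then show "(C * norm b) *\<^sub>R (- ?p *\<^sub>R (\<Sum>i\<in>UNIV. (1 / (b \<bullet> e i)) *\<^sub>R e i)) + ?p *\<^sub>R (C *\<^sub>R sgn b + norm b *\<^sub>R 0) =
        (C * norm b * ?p) *\<^sub>R ((1 / (b \<bullet> b)) *\<^sub>R b - (\<Sum>i\<in>UNIV. (1 / (b \<bullet> e i)) *\<^sub>R e i))"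
      by (simp add: scaleR_diff_right)
  qed
qed

lemma GDERIV_unique: "GDERIV f x :> D \<Longrightarrow> GDERIV f x :> D' \<Longrightarrow> D = D'"
  unfolding gderiv_def
  by (metis has_derivative_unique inner_commute vector_eq_rdot)

text \<open>Moving \<open>b\<close> a distance \<open>d\<close> against \<open>e i\<close> stays in
  the dual cone, so \<open>b \<bullet> e i\<close> is at least
  \<open>d * norm (e i)\<close>.\<close>

lemma interior_dual_cone_hyperangle_pos:
  assumes "b \<in> interior (dual_cone (hyperangle e))" "e i \<noteq> 0"
  shows "b \<bullet> e i > 0"
proof -
  obtain d where d: "d > 0" "cball b d \<subseteq> dual_cone (hyperangle e)"
    using assms(1) mem_interior_cball by blast
  have "b - d *\<^sub>R sgn (e i) \<in> cball b d"
    using d assms(2) by (simp add: dist_norm norm_sgn)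
  moreover have "e i \<in> hyperangle e"
    unfolding hyperangle_def
    by (intro CollectI exI[of _ "\<lambda>j. if j = i then 1 else 0"]) (simp add: if_distrib[of "\<lambda>x. x *\<^sub>R _"] cong: if_cong)
  ultimately have "0 \<le> (b - d *\<^sub>R sgn (e i)) \<bullet> e i"
    using d(2) unfolding dual_cone_def by blast
  moreover have "d * (sgn (e i) \<bullet> e i) > 0"
    using assms(2) d(1) by (simp add: sgn_div_norm)
  ultimately show ?thesis
    by (simp add: inner_diff_left)
qed

text \<open>The multiplier in the definition of stationarity is existential, but pairing with
  \<open>b\<close> determines it: \<open>b\<close> pairs to 1 with \<open>a\<close> and with the
  foot \<open>?H\<close>, and to \<open>CARD('n)\<close> with the vertex sum \<open>?G\<close>, so
  \<open>l = v * (1 - real CARD('n))\<close>.\<close>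

lemma stationary_hyperplane_hyperangle_iff:
  fixes e :: "'n::finite \<Rightarrow> real^'n"
  assumes e: "inj e" "independent (range e)"
    and b: "b \<in> interior (dual_cone (hyperangle e))" and a: "a \<in> hplane b"
  shows "stationary_hyperplane (hyperangle e) a b \<longleftrightarrow>
    (\<Sum>i\<in>UNIV. (1 / (b \<bullet> e i)) *\<^sub>R e i) - (1 / (b \<bullet> b)) *\<^sub>R b = (real CARD('n) - 1) *\<^sub>R a"
proof -
  let ?I = "interior (dual_cone (hyperangle e))"
  let ?G = "\<Sum>i\<in>UNIV. (1 / (b \<bullet> e i)) *\<^sub>R e i" and ?H = "(1 / (b \<bullet> b)) *\<^sub>R b"
  have "e i \<noteq> 0" for i
    using e(2) dependent_zero by (metis rangeI)
  then have pos: "x \<bullet> e i > 0" if "x \<in> ?I" for x i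
    using interior_dual_cone_hyperangle_pos that by blast
  have b0: "b \<noteq> 0" using pos[OF b] by force
  obtain C where C: "C > 0" "\<And>x. (\<And>i. x \<bullet> e i > 0) \<Longrightarrow>
      section_volume (hyperangle e) x = C * norm x * (\<Prod>i\<in>UNIV. 1 / (x \<bullet> e i))"
    using section_volume_hyperangle[OF e] by blast
  define v where "v = C * norm b * (\<Prod>i\<in>UNIV. 1 / (b \<bullet> e i))"
  have "v > 0"
    using C(1) b0 pos[OF b] by (simp add: v_def prod_pos)
  have "GDERIV (\<lambda>x. C * norm x * (\<Prod>i\<in>UNIV. 1 / (x \<bullet> e i))) b :> v *\<^sub>R (?H - ?G)"
    unfolding v_def by (intro GDERIV_norm_mult_prod b0) (metis pos[OF b] less_irrefl)
  \<comment> \<open>The volume formula is known only where all \<open>x \<bullet> e i\<close> are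
    positive; the open set \<open>?I\<close> around \<open>b\<close> lies in that region, which
    suffices for the derivative.\<close>
  then have grad: "GDERIV (section_volume (hyperangle e)) b :> v *\<^sub>R (?H - ?G)"
    unfolding gderiv_def
    by (rule has_derivative_transform_within_open[OF _ open_interior b]) (simp add: C(2) pos)
  have "?G - ?H = (real CARD('n) - 1) *\<^sub>R a" if "v *\<^sub>R (?H - ?G) = l *\<^sub>R a" for l
  proof -
    have "b \<bullet> ?G = real CARD('n)"
      using pos[OF b] by (simp add: inner_sum_right less_imp_neq[THEN not_sym])
    then have "v * (1 - real CARD('n)) = b \<bullet> (v *\<^sub>R (?H - ?G))"
      using b0 by (simp add: inner_diff_right)
    also have "\<dots> = l"
      using a by (simp add: that hplane_def)
    finally have "v *\<^sub>R (?H - ?G) = v *\<^sub>R ((1 - real CARD('n)) *\<^sub>R a)"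
      using that by simp
    then have "?H - ?G = (1 - real CARD('n)) *\<^sub>R a"
      using \<open>v > 0\<close> scaleR_cancel_left[of v] by (simp del: scaleR_scaleR)
    from arg_cong[OF this, of uminus] show ?thesis
      by (simp flip: scaleR_minus_left)
  qed
  moreover have "v *\<^sub>R (?H - ?G) = (v * (1 - real CARD('n))) *\<^sub>R a" if "?G - ?H = (real CARD('n) - 1) *\<^sub>R a"
  proof -
    from arg_cong[OF that, of uminus] have "?H - ?G = (1 - real CARD('n)) *\<^sub>R a"
      by (simp flip: scaleR_minus_left)
    then show ?thesis by simp
  qed
  ultimately have "(\<exists>l. v *\<^sub>R (?H - ?G) = l *\<^sub>R a) \<longleftrightarrow> ?G - ?H = (real CARD('n) - 1) *\<^sub>R a"
    by blast
  moreover have "GDERIV (section_volume (hyperangle e)) b :> D \<longleftrightarrow> v *\<^sub>R (?H - ?G) = D" for D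
    using grad by (intro iffI) (rule GDERIV_unique[OF grad], simp_all)
  ultimately show ?thesis
    using a b by (simp only: stationary_hyperplane_def admissible_def) simp
qed

section \<open>The hyperplane of the simplex and the Monge point\<close>

text \<open>The vertices form a basis of the space, and pairing an expansion of \<open>x\<close>
  with \<open>b\<close> shows that its coefficients sum to 1.\<close>

lemma affine_hull_range_eq_hplane:
  fixes P :: "'n::finite \<Rightarrow> real^'n"
  assumes "det (\<chi> i. P i) \<noteq> 0" and bP: "\<And>i. b \<bullet> P i = 1"
  shows "affine hull (range P) = hplane b"
proof
  show "affine hull (range P) \<subseteq> hplane b"
    using bP by (intro hull_minimal) (auto simp: hplane_def affine_hyperplane)
  show "hplane b \<subseteq> affine hull (range P)"
  proof
    fix x assume x: "x \<in> hplane b"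
    obtain c where c: "x = (\<Sum>i\<in>UNIV. c i *\<^sub>R P i)"
      using obtain_coefficients[OF assms(1)] by blast
    obtain k :: 'n where True by simp
    have "(\<Sum>i\<in>UNIV. c i) = 1"
      using x by (simp add: hplane_def c inner_sum_right bP)
    then have "(\<Sum>i\<in>UNIV. c i *\<^sub>R (P i - P k)) = x - P k"
      by (simp add: c scaleR_diff_right sum_subtractf flip: scaleR_sum_left)
    moreover have "(\<Sum>i\<in>UNIV. c i *\<^sub>R (P i - P k)) \<in> span ((\<lambda>x. x - P k) ` range P)"
      by (intro span_sum span_scale span_base) auto
    ultimately have "x \<in> (\<lambda>y. P k + y) ` span ((\<lambda>x. x - P k) ` range P)"
      by (intro image_eqI[of _ _ "x - P k"]) auto
    then show "x \<in> affine hull (range P)"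
      using affine_hull_span_gen[of "P k" "range P"] by (simp add: hull_inc image_image)
  qed
qed

text \<open>Expand \<open>d\<close> in the basis \<open>P\<close>. The coefficients sum to
  \<open>b \<bullet> d = 0\<close>, and \<open>d \<bullet> d\<close> is that sum times the common
  value \<open>d \<bullet> P k\<close>. This serves both for uniqueness of the Monge point and for
  deriving stationarity.\<close>

lemma eq_zero_if_inner_const:
  fixes P :: "'n::finite \<Rightarrow> real^'n"
  assumes det: "det (\<chi> i. P i) \<noteq> 0" and bP: "\<And>i. b \<bullet> P i = 1"
    and bd: "b \<bullet> d = 0" and const: "\<And>i j. d \<bullet> P i = d \<bullet> P j"
  shows "d = 0"
proof -
  obtain c where c: "d = (\<Sum>i\<in>UNIV. c i *\<^sub>R P i)"
    using obtain_coefficients[OF det] by blast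
  obtain k :: 'n where True by simp
  have "(\<Sum>i\<in>UNIV. c i) = 0"
    using bd by (simp add: c inner_sum_right bP)
  moreover have "d \<bullet> d = (\<Sum>i\<in>UNIV. c i * (d \<bullet> P i))"
    by (subst (2) c) (simp add: inner_sum_right)
  moreover have "\<dots> = (\<Sum>i\<in>UNIV. c i * (d \<bullet> P k))"
    by (intro sum.cong refl arg_cong2[where f = "(*)"] const)
  ultimately show ?thesis
    by (simp flip: sum_distrib_right)
qed

text \<open>The vector on the right is \<open>- (real CARD('n) - 2)\<close> times the one on the
  left. At least three vertices make this factor nonzero and the natural subtraction in the
  definition exact.\<close>

lemma orthogonal_opposite_face_centroid_iff:
  fixes P :: "'n::finite \<Rightarrow> 'a::euclidean_space"
  assumes "CARD('n) \<ge> 3" "i \<noteq> j"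
  shows "orthogonal (x - opposite_face_centroid P i j) (P j - P i) \<longleftrightarrow>
    ((\<Sum>k\<in>UNIV. P k) - P i - P j - (real CARD('n) - 2) *\<^sub>R x) \<bullet> (P j - P i) = 0"
proof -
  have "UNIV = insert i (insert j (UNIV - {i, j}))" by auto
  then have "(\<Sum>k\<in>UNIV. P k) = P i + (P j + (\<Sum>k\<in>UNIV - {i, j}. P k))"
    using assms(2) by (metis (no_types, lifting) Diff_iff finite insertCI insertE sum.insert)
  moreover have "(\<Sum>k\<in>UNIV - {i, j}. P k) = (real CARD('n) - 2) *\<^sub>R opposite_face_centroid P i j"
    using assms(1) by (simp add: opposite_face_centroid_def of_nat_diff)
  ultimately have "(\<Sum>k\<in>UNIV. P k) - P i - P j - (real CARD('n) - 2) *\<^sub>R x =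
      - (real CARD('n) - 2) *\<^sub>R (x - opposite_face_centroid P i j)"
    by (simp add: algebra_simps)
  then show ?thesis
    using assms(1) by (simp add: orthogonal_def)
qed

text \<open>\<open>monge_point\<close> is a definite description, so existence and uniqueness of the
  common point come first. The pairs with \<open>i = j\<close> on the right hold trivially.\<close>

lemma eq_monge_point_iff:
  fixes P :: "'n::finite \<Rightarrow> real^'n"
  assumes n: "CARD('n) \<ge> 3" and det: "det (\<chi> i. P i) \<noteq> 0" and bP: "\<And>i. b \<bullet> P i = 1"
    and x: "x \<in> hplane b"
  shows "x = monge_point P \<longleftrightarrow>
    (\<forall>i j. ((\<Sum>k\<in>UNIV. P k) - P i - P j - (real CARD('n) - 2) *\<^sub>R x) \<bullet> (P j - P i) = 0)"
proof -
  let ?S = "\<Sum>k\<in>UNIV. P k"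
  define monge where "monge y \<longleftrightarrow> (\<forall>i j. i \<noteq> j \<longrightarrow> y \<in> monge_hyperplane P i j)" for y
  define E where "E y i j \<longleftrightarrow> (?S - P i - P j - (real CARD('n) - 2) *\<^sub>R y) \<bullet> (P j - P i) = 0" for y i j
  have monge: "monge y \<longleftrightarrow> y \<in> hplane b \<and> (\<forall>i j. E y i j)" for y
  proof -
    \<comment> \<open>Membership in the hyperplane of the simplex is asserted only through pairs of
      distinct indices, so one such pair must exist.\<close>
    obtain i0 j0 :: 'n where "i0 \<noteq> j0"
      using n by (metis One_nat_def UNIV_I card_le_Suc0_iff_eq finite not_less_eq_eq numeral_3_eq_3 Suc_leD)
    moreover have "y \<in> monge_hyperplane P i j \<longleftrightarrow> y \<in> hplane b \<and> E y i j" if "i \<noteq> j" for i j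
      unfolding monge_hyperplane_def affine_hull_range_eq_hplane[OF det bP] E_def
        mem_Collect_eq orthogonal_opposite_face_centroid_iff[OF n that] ..
    moreover have "E y i i" for i
      by (simp add: E_def)
    ultimately show ?thesis
      unfolding monge_def by metis
  qed
  \<comment> \<open>The right-hand side of the edge condition,
    \<open>(?S - P i - P j) \<bullet> (P j - P i)\<close>, is the difference of
    \<open>?S \<bullet> P l - P l \<bullet> P l\<close> at \<open>l = j\<close> and
    \<open>l = i\<close>. Hence it can be met by prescribing the inner product with each vertex
    separately.\<close>
  obtain y where y: "\<And>i. y \<bullet> P i = (?S \<bullet> P i - P i \<bullet> P i) / (real CARD('n) - 2)"
    using obtain_inner_products[OF det, of "\<lambda>i. (?S \<bullet> P i - P i \<bullet> P i) / (real CARD('n) - 2)"] by blast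
  have b0: "b \<noteq> 0" using bP by force
  \<comment> \<open>Adding a multiple of \<open>b\<close> shifts all inner products with vertices
    equally, so the edge conditions survive; this multiple brings the point into the
    hyperplane.\<close>
  define m where "m = y + ((1 - b \<bullet> y) / (b \<bullet> b)) *\<^sub>R b"
  have "m \<in> hplane b"
    using b0 by (simp add: hplane_def m_def inner_add_right)
  moreover have "E m i j" for i j
  proof -
    have "(real CARD('n) - 2) * (m \<bullet> (P j - P i)) = (?S - P i - P j) \<bullet> (P j - P i)"
    proof -
      have "m \<bullet> (P j - P i) = y \<bullet> P j - y \<bullet> P i"
        by (simp add: m_def inner_add_left inner_diff_right bP)
      then show ?thesis
        using n by (simp add: y diff_divide_distrib[symmetric] inner_diff_left inner_diff_right inner_commute)
    qed
    then show ?thesis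
      by (simp add: E_def inner_diff_left)
  qed
  ultimately have m: "monge m"
    unfolding monge by blast
  have monge_inner: "(real CARD('n) - 2) * (z \<bullet> (P j - P i)) = (?S - P i - P j) \<bullet> (P j - P i)"
    if "monge z" for z i j
  proof -
    have "(?S - P i - P j - (real CARD('n) - 2) *\<^sub>R z) \<bullet> (P j - P i) = 0"
      using that unfolding monge E_def by blast
    then show ?thesis
      by (simp add: inner_diff_left)
  qed
  have unique: "z = m" if "monge z" for z
  proof -
    have "(z - m) \<bullet> (P j - P i) = 0" for i j
    proof -
      have "(real CARD('n) - 2) * ((z - m) \<bullet> (P j - P i)) = 0"
        using monge_inner[OF m, of j i] monge_inner[OF that, of j i]
        by (simp add: inner_diff_left[of z m] right_diff_distrib)
      then show ?thesis using n by auto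
    qed
    then have const: "(z - m) \<bullet> P i = (z - m) \<bullet> P j" for i j
      by (simp add: inner_diff_right)
    have "b \<bullet> (z - m) = 0"
      using m that by (simp add: monge hplane_def inner_diff_right)
    then have "z - m = 0"
      using const by (rule eq_zero_if_inner_const[OF det bP])
    then show ?thesis by simp
  qed
  have "monge_point P = (THE y. monge y)"
    by (simp add: monge_point_def monge_def)
  also have "\<dots> = m"
    using m unique by (rule the_equality)
  finally have "x = monge_point P \<longleftrightarrow> monge x"
    using m unique by blast
  then show ?thesis
    using x unfolding monge E_def by (simp only: simp_thms)
qed

section \<open>Foot of the perpendicular, equal distances and the three conditions\<close>

lemma hplane_Int_ray:
  assumes "b \<bullet> v > 0"
  shows "hplane b \<inter> {t *\<^sub>R v | t. 0 \<le> t} = {(1 / (b \<bullet> v)) *\<^sub>R v}"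
proof -
  have "t *\<^sub>R v \<in> hplane b \<longleftrightarrow> t = 1 / (b \<bullet> v)" for t
    using assms by (auto simp: hplane_def field_simps)
  moreover have "0 \<le> 1 / (b \<bullet> v)" using assms by simp
  ultimately show ?thesis by auto
qed

text \<open>Both \<open>H\<close> and \<open>?c\<close> are orthogonal to \<open>?c - H\<close>: the
  former by the projection property, the latter as a multiple of the normal
  \<open>b\<close>.\<close>

lemma orthogonal_projection_of_0_hplane:
  assumes "orthogonal_projection_of 0 (hplane b) H" "b \<noteq> 0"
  shows "H = (1 / (b \<bullet> b)) *\<^sub>R b"
proof -
  let ?c = "(1 / (b \<bullet> b)) *\<^sub>R b"
  have H: "b \<bullet> H = 1" "?c \<in> hplane b"
    using assms by (auto simp: orthogonal_projection_of_def hplane_def)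
  then have "H \<bullet> (?c - H) = 0"
    using assms(1) by (auto simp: orthogonal_projection_of_def orthogonal_def)
  moreover have "?c \<bullet> (?c - H) = 0"
    using H assms(2) by (simp add: inner_diff_right)
  ultimately have "(?c - H) \<bullet> (?c - H) = 0"
    by (simp only: inner_diff_left)
  then show ?thesis by simp
qed

text \<open>The inner product on the right is the difference of the squared distances from
  \<open>x\<close> to \<open>P j\<close> and to \<open>P i\<close>.\<close>

lemma all_dist_eq_iff_inner:
  fixes P :: "'i \<Rightarrow> 'a::euclidean_space"
  shows "(\<forall>i j. dist x (P i) = dist x (P j)) \<longleftrightarrow> (\<forall>i j. (P i + P j - 2 *\<^sub>R x) \<bullet> (P j - P i) = 0)"
proof -
  have "dist x (P i) = dist x (P j) \<longleftrightarrow> (P i + P j - 2 *\<^sub>R x) \<bullet> (P j - P i) = 0" for i j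
    by (simp add: dist_norm norm_eq_sqrt_inner inner_diff_left inner_diff_right inner_add_left
        scaleR_2 inner_commute) (auto simp: algebra_simps inner_commute)
  then show ?thesis by simp
qed

theorem proposition1:
  fixes e P :: "'n::finite \<Rightarrow> real ^ 'n"
    and K :: "(real ^ 'n) set"
    and a a' b H :: "real ^ 'n"
  assumes "CARD('n) \<ge> 3"
    and "inj e" and "independent (range e)"
    and "K = hyperangle e"
    and "b \<in> interior (dual_cone K)"
    and "a \<in> hplane b"
    and "\<And>i. hplane b \<inter> {t *\<^sub>R e i | t. 0 \<le> t} = {P i}"
    and "orthogonal_projection_of 0 (hplane b) H"
    and "a' = ((real CARD('n) - 1) / 2) *\<^sub>R a"
  defines "cond_i \<equiv> stationary_hyperplane K a b"
    and "cond_ii \<equiv> (\<forall>i j. dist a' (P i) = dist a' (P j))"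
    and "cond_iii \<equiv> (H = monge_point P)"
  shows "(cond_i \<and> cond_ii \<longrightarrow> cond_iii) \<and>
         (cond_i \<and> cond_iii \<longrightarrow> cond_ii) \<and>
         (cond_ii \<and> cond_iii \<longrightarrow> cond_i)"
proof -
  have e: "inj e" "independent (range e)" and n: "CARD('n) \<ge> 3"
    using assms by auto
  have b: "b \<in> interior (dual_cone (hyperangle e))"
    using assms by simp
  have "e i \<noteq> 0" for i
    using e(2) dependent_zero by (metis rangeI)
  then have pos: "b \<bullet> e i > 0" for i
    using interior_dual_cone_hyperangle_pos[OF b] by blast
  then have b0: "b \<noteq> 0" by force
  have P: "P i = (1 / (b \<bullet> e i)) *\<^sub>R e i" for i
    using assms(7)[of i] hplane_Int_ray[OF pos[of i]] by simp
  have bP: "b \<bullet> P i = 1" for i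
    using pos[of i] by (simp add: P)
  have "det (\<chi> i. P i) = (\<Prod>i\<in>UNIV. 1 / (b \<bullet> e i)) * det (\<chi> i. e i)"
    unfolding P scalar_mult_eq_scaleR[symmetric] by (rule det_rows_mul)
  then have det: "det (\<chi> i. P i) \<noteq> 0"
    using det_rows_nonzero[OF e] pos by (simp add: less_imp_neq[THEN not_sym])
  have H: "H = (1 / (b \<bullet> b)) *\<^sub>R b"
    using orthogonal_projection_of_0_hplane assms(8) b0 by blast
  have bH: "b \<bullet> H = 1" and HP: "H \<bullet> (P j - P i) = 0" for i j
    using b0 by (simp_all add: H bP inner_diff_right)
  have ba: "b \<bullet> a = 1"
    using assms(6) by (simp add: hplane_def)
  define S where "S = (\<Sum>i\<in>UNIV. P i)"
  let ?n = "real CARD('n)"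
  have i: "cond_i \<longleftrightarrow> S - H = (?n - 1) *\<^sub>R a"
    unfolding cond_i_def assms(4) S_def H P
    by (rule stationary_hyperplane_hyperangle_iff[OF e b assms(6)])
  have ii: "cond_ii \<longleftrightarrow> (\<forall>i j. (P i + P j - (?n - 1) *\<^sub>R a) \<bullet> (P j - P i) = 0)"
  proof -
    \<comment> \<open>The factor one half in \<open>a'\<close> cancels the 2 coming from the squared
      distances.\<close>
    have "2 * ((?n - 1) / 2) = ?n - 1" by simp
    then have "2 *\<^sub>R a' = (?n - 1) *\<^sub>R a"
      unfolding assms(9) scaleR_scaleR by (rule arg_cong)
    then show ?thesis
      unfolding cond_ii_def all_dist_eq_iff_inner by simp
  qed
  have "cond_iii \<longleftrightarrow> (\<forall>i j. (S - P i - P j - (?n - 2) *\<^sub>R H) \<bullet> (P j - P i) = 0)"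
    unfolding cond_iii_def S_def
    using bH by (intro eq_monge_point_iff[OF n det bP]) (simp add: hplane_def)
  \<comment> \<open>\<open>H\<close> is orthogonal to all edges, so its multiple drops out.\<close>
  then have iii: "cond_iii \<longleftrightarrow> (\<forall>i j. (S - P i - P j) \<bullet> (P j - P i) = 0)"
    by (simp add: inner_diff_left[of _ "(?n - 2) *\<^sub>R H"] HP)
  \<comment> \<open>Under stationarity the vectors in \<open>ii\<close> and \<open>iii\<close> add
    up to \<open>H\<close>, which is orthogonal to the edges; this settles two of the three
    implications.\<close>
  have ii_iff_iii: "cond_ii \<longleftrightarrow> cond_iii" if cond_i
  proof -
    have S: "S = H + (?n - 1) *\<^sub>R a"
      using that i by (simp add: algebra_simps)
    have "(S - P i - P j) \<bullet> (P j - P i) = - ((P i + P j - (?n - 1) *\<^sub>R a) \<bullet> (P j - P i))" for i j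
      using HP[of j i] by (simp add: S inner_diff_left inner_add_left)
    then show ?thesis
      unfolding ii iii by simp
  qed
  moreover have cond_i if cond_ii cond_iii
  proof -
    \<comment> \<open>The defect in the stationarity equation. It is orthogonal to the edges by
      \<open>ii\<close> and \<open>iii\<close>, and to \<open>b\<close> because
      \<open>?n - (?n - 1) - 1 = 0\<close>.\<close>
    define d where "d = S - (?n - 1) *\<^sub>R a - H"
    have "d \<bullet> (P j - P i) =
        (P i + P j - (?n - 1) *\<^sub>R a) \<bullet> (P j - P i) + (S - P i - P j) \<bullet> (P j - P i) - H \<bullet> (P j - P i)" for i j
      by (simp add: d_def inner_diff_left inner_add_left)
    then have "d \<bullet> (P j - P i) = 0" for i j
      using that HP unfolding ii iii by simp
    then have const: "d \<bullet> P i = d \<bullet> P j" for i j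
      by (simp add: inner_diff_right)
    have "b \<bullet> S = ?n"
      by (simp add: S_def inner_sum_right bP)
    then have "b \<bullet> d = 0"
      by (simp add: d_def inner_diff_right bH ba)
    then have "d = 0"
      using const by (rule eq_zero_if_inner_const[OF det bP])
    then show ?thesis
      unfolding i d_def by (simp add: algebra_simps)
  qed
  ultimately show ?thesis by blast
qed

end
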